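(* Let $n$ be a positive integer, let $C\subseteq[n]$, let $\mathcal H\subseteq 2^{[n]\setminus C}$ be a family of subsets of $[n]\setminus C$, and let $\alpha_H\ge 0$ be a real number for each $H\in\mathcal H$. Define $\phi:\{0,1\}^n\to\mathbb R$ by $$\phi(x)=\sum_{H\in\mathcal H}\alpha_H\prod_{j\in H\cup C}x_j .$$ Then for all $x\in\{0,1\}^n$, $$\phi(x)=\min_{w\in\{0,1\}}\left[\left(\sum_{H\in\mathcal H}\alpha_H\right)\overline{w}\prod_{j\in C}x_j+\sum_{H\in\mathcal H}\alpha_H\, w\prod_{j\in H}x_j\right],$$ where $\overline{w}=1-w$.
   Context: $[n]=\{1,2,\dots,n\}$ and $2^{[n]\setminus C}$ denotes the family of all subsets of $[n]\setminus C$. Empty sums equal $0$ and empty products equal $1$. *)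

theory Defs
  imports Complex_Main "HOL-Library.FuncSet"
begin

text \<open>
  A 0-1 vector with coordinates indexed by 1, ..., n: an extensional function on
  \<^term>\<open>{1..n}\<close> whose values are the real numbers 0 and 1.
\<close>

definition binary_cube :: "nat \<Rightarrow> (nat \<Rightarrow> real) set" where
  "binary_cube n = ({1..n} \<rightarrow>\<^sub>E {0, 1})"

end

theory Submission
  imports Defs
begin

text \<open>Fix \<open>x\<close> and let \<open>P\<close> be the product over \<open>C\<close>,
  \<open>S\<close> the sum of all weights, and \<open>T\<close> the weighted sum of the products
  over the sets H. Every H avoids \<open>C\<close>, so the common factor comes out and
  \<open>\<phi> x = T * P\<close>. The bracket takes the value \<open>S * P\<close> at
  \<open>w = 0\<close> and \<open>T\<close> at \<open>w = 1\<close>. By \<open>prod_binary\<close>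
  all products are 0 or 1, so nonnegative weights give \<open>0 \<le> T \<le> S\<close>, and the two
  cases \<open>P = 0\<close> and \<open>P = 1\<close> settle the identity.\<close>

lemma prod_binary:
  fixes x :: "nat \<Rightarrow> real"
  assumes "x \<in> binary_cube n" "A \<subseteq> {1..n}"
  shows "(\<Prod>j\<in>A. x j) \<in> {0, 1}"
proof -
  have "finite A"
    using assms(2) finite_subset by blast
  moreover have "\<forall>j\<in>A. x j \<in> {0, 1}"
    using assms unfolding binary_cube_def by (blast dest: PiE_mem)
  ultimately show ?thesis
    by (induction A rule: finite_induct) auto
qed

theorem theorem2:
  fixes n :: nat
    and C :: "nat set"
    and \<H> :: "nat set set"
    and \<alpha> :: "nat set \<Rightarrow> real"
    and \<phi> :: "(nat \<Rightarrow> real) \<Rightarrow> real"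
  assumes "n > 0"
    and "C \<subseteq> {1..n}"
    and "\<H> \<subseteq> Pow ({1..n} - C)"
    and "\<And>H. H \<in> \<H> \<Longrightarrow> \<alpha> H \<ge> 0"
    and "\<And>x. x \<in> binary_cube n \<Longrightarrow> \<phi> x = (\<Sum>H\<in>\<H>. \<alpha> H * (\<Prod>j\<in>H \<union> C. x j))"
  shows "\<forall>x \<in> binary_cube n.
    \<phi> x = (MIN w\<in>{0, 1}. (\<Sum>H\<in>\<H>. \<alpha> H) * (1 - w) * (\<Prod>j\<in>C. x j)
                        + (\<Sum>H\<in>\<H>. \<alpha> H * w * (\<Prod>j\<in>H. x j)))"
proof
  fix x
  assume x: "x \<in> binary_cube n"
  define P where "P = (\<Prod>j\<in>C. x j)"
  define S where "S = (\<Sum>H\<in>\<H>. \<alpha> H)"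
  define T where "T = (\<Sum>H\<in>\<H>. \<alpha> H * (\<Prod>j\<in>H. x j))"
  have sub: "H \<subseteq> {1..n}" if "H \<in> \<H>" for H
    using assms(3) that by blast
  have prod_H: "(\<Prod>j\<in>H. x j) \<in> {0, 1}" if "H \<in> \<H>" for H
    using prod_binary x sub that by blast
  have P: "P \<in> {0, 1}"
    unfolding P_def using prod_binary x assms(2) by blast
  \<comment> \<open>Termwise: a weight at least 0 times a product equal to 0 or 1 lies between 0 and
    that weight.\<close>
  have T: "0 \<le> T" "T \<le> S"
    unfolding T_def S_def using prod_H assms(4)
    by (fastforce intro!: sum_nonneg sum_mono)+
  have "(\<Prod>j\<in>H \<union> C. x j) = (\<Prod>j\<in>H. x j) * P" if "H \<in> \<H>" for H
    unfolding P_def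
  proof (rule prod.union_disjoint)
    show "finite H" "finite C"
      using sub[OF that] assms(2) by (auto intro: finite_subset)
    show "H \<inter> C = {}"
      using assms(3) that by blast
  qed
  then have "\<phi> x = T * P"
    using assms(5)[OF x] by (simp add: T_def sum_distrib_right mult.assoc)
  \<comment> \<open>If \<open>P = 0\<close>, both sides are 0 because \<open>0 \<le> T\<close>; if
    \<open>P = 1\<close>, both are \<open>T\<close> because \<open>T \<le> S\<close>.\<close>
  also have "\<dots> = min (S * P) T"
    using P T by auto
  \<comment> \<open>The minimum over two points is a binary \<open>min\<close>: at
    \<open>w = 0\<close> the sum over H vanishes, at \<open>w = 1\<close> the term with
    \<open>S\<close> does.\<close>
  also have "\<dots> = (MIN w\<in>{0, 1}. S * (1 - w) * P + (\<Sum>H\<in>\<H>. \<alpha> H * w * (\<Prod>j\<in>H. x j)))"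
    by (simp add: T_def)
  finally show "\<phi> x = (MIN w\<in>{0, 1}. (\<Sum>H\<in>\<H>. \<alpha> H) * (1 - w) * (\<Prod>j\<in>C. x j)
                        + (\<Sum>H\<in>\<H>. \<alpha> H * w * (\<Prod>j\<in>H. x j)))"
    unfolding S_def P_def .
qed

end
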